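(* Let $\mathcal{H}$ be a real Hilbert space, let $T_i:\mathcal{H}\to\mathcal{H}$, $i=1,\ldots,m$, be cutters with $\bigcap_{i=1}^m \mathrm{Fix}\,T_i\neq\emptyset$, and let $F:\mathcal{H}\to\mathcal{H}$ be $\eta$-strongly monotone and $\kappa$-Lipschitz continuous. Let $\mu\in(0,2\eta/\kappa^2)$, $\{\beta_n\}_{n=1}^\infty\subset(0,1]$, $\{\varphi_n\}_{n=1}^\infty\subset[0,\infty)$, let $\{\lambda_n\}_{n=1}^\infty$ be a positive sequence, let $x^1\in\mathcal{H}$ be arbitrary, and let $\{x^n\}_{n=1}^\infty$ be the sequence generated by the algorithm ESCoM-CGD described in the context. Suppose that $\lim_{n\to\infty}\beta_n=0$, $\sum_{n=1}^\infty\beta_n=\infty$, $\lim_{n\to\infty}\varphi_n=0$, and $\{\lambda_n\}_{n=1}^\infty\subset[\varepsilon,2-\varepsilon]$ for some constant $\varepsilon\in(0,1)$. If $\{F(x^n)\}_{n=1}^\infty$ is bounded and each $T_i$, $i=1,\ldots,m$, satisfies the demi-closedness (DC) principle, then $\{x^n\}_{n=1}^\infty$ converges strongly (in norm) to $\bar u$, the unique solution of the variational inequality problem: find $\bar u\in\bigcap_{i=1}^m \mathrm{Fix}\,T_i$ such that $\langle F(\bar u),z-\bar u\rangle\ge 0$ for all $z\in\bigcap_{i=1}^m\mathrm{Fix}\,T_i$.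
   Context: $\mathcal{H}$ is a real Hilbert space with inner product $\langle\cdot,\cdot\rangle$ and norm $\|\cdot\|$; $\mathrm{Id}$ is the identity operator; $\mathrm{Fix}\,T=\{x\in\mathcal{H}:Tx=x\}$. An operator $T:\mathcal{H}\to\mathcal{H}$ with $\mathrm{Fix}\,T\ne\emptyset$ is a cutter if $\langle x-Tx,z-Tx\rangle\le0$ for all $x\in\mathcal{H}$ and $z\in\mathrm{Fix}\,T$. $F$ is $\eta$-strongly monotone ($\eta>0$) if $\langle Fx-Fy,x-y\rangle\ge\eta\|x-y\|^2$ for all $x,y\in\mathcal{H}$, and $\kappa$-Lipschitz continuous ($\kappa>0$) if $\|Fx-Fy\|\le\kappa\|x-y\|$ for all $x,y\in\mathcal{H}$. An operator $T$ satisfies the demi-closedness (DC) principle if for any sequence $\{x^n\}\subset\mathcal{H}$, $x^n\rightharpoonup y\in\mathcal{H}$ (weakly) and $\|(T-\mathrm{Id})x^n\|\to0$ imply $Ty=y$. Notation: $T:=T_mT_{m-1}\cdots T_1$, $S_0:=\mathrm{Id}$, $S_i:=T_iT_{i-1}\cdots T_1$ for $i=1,\ldots,m$. Algorithm ESCoM-CGD: given $x^1\in\mathcal{H}$, set $d^1:=-F(x^1)$. For $n=1,2,\ldots$ compute $$y^n:=x^n+\mu\beta_nd^n,$$ $$\sigma(y^n):=\begin{cases}\dfrac{\sum_{i=1}^m\langle Ty^n-S_{i-1}y^n,\,S_iy^n-S_{i-1}y^n\rangle}{\|Ty^n-y^n\|^2},& y^n\notin\bigcap_{i=1}^m\mathrm{Fix}\,T_i,\\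 1,&\text{otherwise,}\end{cases}$$ $$x^{n+1}:=T_m\big(y^n+\lambda_n\sigma(y^n)(Ty^n-y^n)\big),\qquad d^{n+1}:=-F(x^{n+1})+\varphi_{n+1}d^n.$$ *)

theory Defs
  imports "HOL-Analysis.Analysis"
begin

definition Fix :: "('a \<Rightarrow> 'a) \<Rightarrow> 'a set" where
  "Fix T = {x. T x = x}"

definition cutter :: "('a::real_inner \<Rightarrow> 'a) \<Rightarrow> bool" where
  "cutter T \<longleftrightarrow> Fix T \<noteq> {} \<and> (\<forall>x. \<forall>z\<in>Fix T. inner (x - T x) (z - T x) \<le> 0)"

definition strongly_monotone :: "real \<Rightarrow> ('a::real_inner \<Rightarrow> 'a) \<Rightarrow> bool" where
  "strongly_monotone \<eta> F \<longleftrightarrow>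
     \<eta> > 0 \<and> (\<forall>x y. inner (F x - F y) (x - y) \<ge> \<eta> * (norm (x - y))\<^sup>2)"

text \<open>The usual Hilbert-space form of weak convergence: by the Riesz representation theorem
  the functionals \<open>inner z\<close> are exactly the continuous linear functionals.\<close>

definition weakly_converges :: "(nat \<Rightarrow> 'a::real_inner) \<Rightarrow> 'a \<Rightarrow> bool" where
  "weakly_converges s y \<longleftrightarrow> (\<forall>z. (\<lambda>n. inner z (s n)) \<longlonglongrightarrow> inner z y)"

definition demiclosed_principle :: "('a::real_inner \<Rightarrow> 'a) \<Rightarrow> bool" where
  "demiclosed_principle T \<longleftrightarrow>
     (\<forall>s y. weakly_converges s y \<longrightarrow> (\<lambda>n. norm (T (s n) - s n)) \<longlonglongrightarrow> 0 \<longrightarrow> T y = y)"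

definition vi_solution :: "('a::real_inner \<Rightarrow> 'a) \<Rightarrow> 'a set \<Rightarrow> 'a \<Rightarrow> bool" where
  "vi_solution F C u \<longleftrightarrow> u \<in> C \<and> (\<forall>z\<in>C. inner (F u) (z - u) \<ge> 0)"

text \<open>\<open>partial_comp T i\<close> is \<open>S\<^sub>i = T\<^sub>i \<circ> \<dots> \<circ> T\<^sub>1\<close>; the value \<open>T 0\<close> is never used.\<close>

primrec partial_comp :: "(nat \<Rightarrow> 'a \<Rightarrow> 'a) \<Rightarrow> nat \<Rightarrow> 'a \<Rightarrow> 'a" where
  "partial_comp T 0 = id"
| "partial_comp T (Suc i) = T (Suc i) \<circ> partial_comp T i"

definition step_size :: "nat \<Rightarrow> (nat \<Rightarrow> 'a::real_inner \<Rightarrow> 'a) \<Rightarrow> 'a \<Rightarrow> real" where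
  "step_size m T y =
     (if y \<notin> (\<Inter>i\<in>{1..m}. Fix (T i))
      then (\<Sum>i=1..m. inner (partial_comp T m y - partial_comp T (i - 1) y)
                            (partial_comp T i y - partial_comp T (i - 1) y))
             / (norm (partial_comp T m y - y))\<^sup>2
      else 1)"

text \<open>Sequences are indexed from 1; their values at 0 are unconstrained. The relation determines
  all values at positive indices from the starting point \<open>x 1\<close>.\<close>

definition escom_cgd ::
  "nat \<Rightarrow> (nat \<Rightarrow> 'a::real_inner \<Rightarrow> 'a) \<Rightarrow> ('a \<Rightarrow> 'a) \<Rightarrow> real \<Rightarrow> (nat \<Rightarrow> real) \<Rightarrow> (nat \<Rightarrow> real) \<Rightarrow>
   (nat \<Rightarrow> real) \<Rightarrow> (nat \<Rightarrow> 'a) \<Rightarrow> (nat \<Rightarrow> 'a) \<Rightarrow> (nat \<Rightarrow> 'a) \<Rightarrow> bool" where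
  "escom_cgd m T F \<mu> \<beta> \<phi> lam x y d \<longleftrightarrow>
     d 1 = - F (x 1) \<and>
     (\<forall>n\<ge>1.
        y n = x n + (\<mu> * \<beta> n) *\<^sub>R d n \<and>
        x (n + 1) = T m (y n + (lam n * step_size m T (y n)) *\<^sub>R (partial_comp T m (y n) - y n)) \<and>
        d (n + 1) = - F (x (n + 1)) + \<phi> (n + 1) *\<^sub>R d n)"

end

theory Submission
  imports Defs
begin

text \<open>
  Write \<open>C\<close> for the common fixed point set, \<open>u\<close> for the solution of the variational inequality over
  \<open>C\<close>, \<open>s n\<close> for \<open>\<parallel>x n - u\<parallel>\<^sup>2\<close> and \<open>A(y)\<close> for the sum of the squared displacements
  \<open>\<parallel>S\<^sub>i y - S\<^sub>i\<^sub>-\<^sub>1 y\<parallel>\<^sup>2\<close> along the chain \<open>y, T\<^sub>1 y, T\<^sub>2 T\<^sub>1 y, \<dots>\<close>.  The fixed point sets of cutters are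
  intersections of half-spaces, so \<open>C\<close> is closed and convex, and \<open>u\<close> exists because \<open>v \<mapsto> P\<^sub>C (v - t F v)\<close>
  is a contraction for a suitable \<open>t\<close>; strong monotonicity makes \<open>u\<close> unique.

  Convergence combines two effects.  The numerator of \<open>\<sigma>(y)\<close> equals half of
  \<open>A(y) + \<parallel>T y - y\<parallel>\<^sup>2\<close>, and the telescoped cutter inequalities bound it by \<open>\<langle>T y - y, z - y\<rangle>\<close> for
  every \<open>z \<in> C\<close>.  Thus \<open>\<sigma> \<ge> 1/2\<close>, and with relaxation bounded away from 0 and 2 the
  extrapolated step reduces the squared distance to \<open>u\<close> by at least a fixed multiple of \<open>A(y n)\<close>
  (\<open>extrapolated_step_dist_decrease\<close>).  The gradient step, on the other hand, contributes
  \<open>\<langle>d n, x n - u\<rangle>\<close>, which strong monotonicity bounds by \<open>- \<eta> s n - \<langle>F u, x n - u\<rangle>\<close> plus a term of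
  order \<open>\<phi> n\<close>; the directions \<open>d n\<close> stay bounded because \<open>F (x n)\<close> is bounded and
  \<open>\<phi> n\<close> tends to zero.  Together,
  \<open>s (n + 1) \<le> (1 - g \<beta> n) s n + \<beta> n b n - c A(y n)\<close> with
  \<open>b n = - 2 \<mu> \<langle>F u, x n - u\<rangle> + o(1)\<close>.

  The sign of \<open>b n\<close> is uncontrolled in general, but along any subsequence on which \<open>A(y n)\<close> vanishes,
  a weakly convergent further subsequence has its limit \<open>p\<close> in \<open>C\<close> by the demi-closedness principle
  (\<open>weak_limit_in_common_Fix\<close>), and \<open>\<langle>F u, p - u\<rangle> \<ge> 0\<close>.  So for every \<open>e > 0\<close> there is a dichotomy for
  late \<open>n\<close>: either \<open>A(y n)\<close> is small and then \<open>b n \<le> e\<close>, or \<open>A(y n)\<close> exceeds a fixed constant and then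
  it dominates the whole perturbation \<open>\<beta> n b n\<close>, which tends to zero.  In both cases the same recursion
  with \<open>b n\<close> replaced by \<open>e\<close> holds, and divergence of the sum of the \<open>\<beta> n\<close> forces \<open>s n\<close> below a
  multiple of \<open>e\<close> (\<open>perturbed_descent_tendsto_0\<close>).

  The weak compactness of bounded sequences is obtained from a single geometric fact: a decreasing
  sequence of closed convex sets, each of which meets a fixed ball, has a common point
  (\<open>nested_closed_convex_meet\<close>).  With a constant sequence it gives metric projections, with the
  closed convex hulls of tails it gives weak limits.
\<close>

section \<open>Projections and weak compactness in Hilbert space\<close>

text \<open>The parallelogram law: the midpoint of \<open>x\<close> and \<open>y\<close> stays in \<open>K\<close>, so two points of \<open>K\<close> that are
  almost nearest to \<open>a\<close> are close to each other.\<close>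

lemma convex_dist_parallelogram:
  fixes a :: "'a::real_inner"
  assumes "convex K" "x \<in> K" "y \<in> K"
  shows "(dist x y)\<^sup>2 \<le> 2 * (dist a x)\<^sup>2 + 2 * (dist a y)\<^sup>2 - 4 * (infdist a K)\<^sup>2"
proof -
  define c where "c = (1/2) *\<^sub>R x + (1/2) *\<^sub>R y"
  have "c \<in> K"
    unfolding c_def using assms by (intro convexD) auto
  then have "infdist a K \<le> dist a c"
    by (rule infdist_le)
  then have "(infdist a K)\<^sup>2 \<le> (dist a c)\<^sup>2"
    by (intro power_mono infdist_nonneg)
  moreover have "(dist x y)\<^sup>2 = 2 * (dist a x)\<^sup>2 + 2 * (dist a y)\<^sup>2 - 4 * (dist a c)\<^sup>2"
    unfolding c_def dist_norm power2_norm_eq_inner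
    by (simp add: inner_diff_left inner_diff_right inner_add_left inner_add_right
        inner_commute algebra_simps)
  ultimately show ?thesis by simp
qed

text \<open>Let \<open>D\<close> be the limit of the increasing distances from \<open>a\<close> to \<open>K k\<close>.  Cutting \<open>K k\<close> down to the ball
  around \<open>a\<close> whose radius decreases to \<open>D\<close> from above gives nested closed nonempty sets, and the parallelogram law makes
  their diameters vanish; completeness then provides a common point.\<close>

lemma nested_closed_convex_meet:
  fixes K :: "nat \<Rightarrow> 'a::{real_inner, complete_space} set"
  assumes cl: "\<And>k. closed (K k)" and cv: "\<And>k. convex (K k)" and ne: "\<And>k. K k \<noteq> {}"
    and dec: "\<And>k l. k \<le> l \<Longrightarrow> K l \<subseteq> K k"
    and bnd: "\<And>k. infdist a (K k) \<le> B"
  shows "\<exists>p. \<forall>k. p \<in> K k \<and> dist a p \<le> (SUP k. infdist a (K k))"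
proof -
  define D where "D = (SUP k. infdist a (K k))"
  have bdd: "bdd_above (range (\<lambda>k. infdist a (K k)))"
    using bnd by (intro bdd_aboveI[of _ B]) auto
  have leD: "infdist a (K k) \<le> D" for k
    unfolding D_def using bdd by (intro cSUP_upper) auto
  have "incseq (\<lambda>k. infdist a (K k))"
    using dec ne by (intro monoI infdist_mono) auto
  then have lim1: "(\<lambda>k. infdist a (K k)) \<longlonglongrightarrow> D"
    unfolding D_def by (intro LIMSEQ_incseq_SUP bdd)
  define \<rho> where "\<rho> k = D + inverse (real (Suc k))" for k
  have lim2: "\<rho> \<longlonglongrightarrow> D"
    unfolding \<rho>_def using tendsto_add[OF tendsto_const LIMSEQ_inverse_real_of_nat, of D] by simp
  define S where "S k = K k \<inter> cball a (\<rho> k)" for k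
  have "\<exists>p. \<Inter>(range S) = {p}"
  proof (rule decreasing_closed_nest_sing)
    show "closed (S k)" for k
      unfolding S_def using cl by auto
    show "S k \<noteq> {}" for k
    proof -
      have "infdist a (K k) < \<rho> k"
        using leD[of k] unfolding \<rho>_def by (simp add: add_strict_increasing2 le_less_trans)
      then obtain z where "z \<in> K k" "dist a z < \<rho> k"
        using cInf_lessD[of "dist a ` K k" "\<rho> k"] ne[of k] by (auto simp: infdist_def)
      then show ?thesis unfolding S_def by auto
    qed
    show "S l \<subseteq> S k" if "k \<le> l" for k l
    proof -
      have "\<rho> l \<le> \<rho> k" unfolding \<rho>_def using that by (simp add: field_simps)
      then show ?thesis unfolding S_def using dec[OF that] by auto
    qed
    show "\<exists>n. \<forall>x\<in>S n. \<forall>y\<in>S n. dist x y < e" if "e > 0" for e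
    proof -
      have "(\<lambda>k. 4 * (\<rho> k)\<^sup>2 - 4 * (infdist a (K k))\<^sup>2) \<longlonglongrightarrow> 4 * D\<^sup>2 - 4 * D\<^sup>2"
        by (intro tendsto_intros lim1 lim2)
      then have "eventually (\<lambda>k. 4 * (\<rho> k)\<^sup>2 - 4 * (infdist a (K k))\<^sup>2 < e\<^sup>2) sequentially"
        using that by (intro order_tendstoD) auto
      then obtain n where n: "4 * (\<rho> n)\<^sup>2 - 4 * (infdist a (K n))\<^sup>2 < e\<^sup>2"
        by (auto simp: eventually_sequentially)
      have "dist x y < e" if "x \<in> S n" "y \<in> S n" for x y
      proof -
        have "(dist a x)\<^sup>2 \<le> (\<rho> n)\<^sup>2" "(dist a y)\<^sup>2 \<le> (\<rho> n)\<^sup>2"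
          using that unfolding S_def by (auto intro!: power_mono)
        with convex_dist_parallelogram[OF cv, of x n y a] that n
        have "(dist x y)\<^sup>2 < e\<^sup>2" unfolding S_def by auto
        then show ?thesis using \<open>e > 0\<close> by (simp add: power2_less_imp_less)
      qed
      then show ?thesis by blast
    qed
  qed
  then obtain p where "\<Inter>(range S) = {p}" by blast
  then have p: "p \<in> S k" for k by auto
  have "dist a p \<le> D"
    using p unfolding S_def
    by (intro LIMSEQ_le_const[OF lim2]) auto
  then show ?thesis using p unfolding S_def D_def by auto
qed

text \<open>A nearest point is a common point of the constant sequence \<open>C\<close>.  An acute angle at it towards
  some \<open>z \<in> C\<close> would put a nearer point on the segment to \<open>z\<close>.\<close>

lemma projection_on_closed_convex:
  fixes C :: "'a::{real_inner, complete_space} set"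
  assumes "closed C" "convex C" "C \<noteq> {}"
  shows "\<exists>p\<in>C. \<forall>z\<in>C. inner (a - p) (z - p) \<le> 0"
proof -
  obtain p where p: "p \<in> C" "dist a p \<le> infdist a C"
    using nested_closed_convex_meet[of "\<lambda>_. C" a "infdist a C"] assms by auto
  have "inner (a - p) (z - p) \<le> 0" if "z \<in> C" for z
  proof (rule ccontr)
    assume "\<not> ?thesis"
    then obtain u where u: "0 < u" "u \<le> 1" "dist (p + u *\<^sub>R (z - p)) a < dist p a"
      using closer_point_lemma[of a p z] by auto
    have "(1 - u) *\<^sub>R p + u *\<^sub>R z \<in> C"
      using assms(2) p(1) that u by (intro convexD) auto
    then have "infdist a C \<le> dist a (p + u *\<^sub>R (z - p))"
      by (intro infdist_le) (simp add: algebra_simps)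
    with u p show False by (simp add: dist_commute)
  qed
  with p show ?thesis by blast
qed

text \<open>The diagonal argument in topological form: a countable product of compact intervals is compact,
  and metrizable, hence sequentially compact.\<close>

lemma bounded_real_diagonal_subsequence:
  fixes f :: "nat \<Rightarrow> nat \<Rightarrow> real"
  assumes "\<And>k n. \<bar>f n k\<bar> \<le> B k"
  shows "\<exists>r. strict_mono r \<and> (\<forall>k. convergent (\<lambda>n. f (r n) k))"
proof -
  define Q where "Q = PiE (UNIV :: nat set) (\<lambda>k. {- B k .. B k})"
  have "compactin (product_topology (\<lambda>_. euclidean) UNIV) Q"
    unfolding Q_def by (simp add: compactin_PiE)
  then have "compact Q"
    by (simp add: euclidean_product_topology)
  then have "seq_compact Q"
    by (simp add: compact_eq_seq_compact_metric)
  moreover have "f n \<in> Q" for n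
    using assms unfolding Q_def by (auto simp: abs_le_iff minus_le_iff)
  ultimately obtain l r where r: "strict_mono r" "(f \<circ> r) \<longlonglongrightarrow> l"
    unfolding seq_compact_def by blast
  have "(\<lambda>n. f (r n) k) \<longlonglongrightarrow> l k" for k
  proof -
    have "continuous_on UNIV (\<lambda>g. g k :: real)"
      by (rule continuous_on_product_coordinates)
    from continuous_on_tendsto_compose[OF this r(2)] show ?thesis
      by (simp add: o_def)
  qed
  with r(1) show ?thesis
    unfolding convergent_def by blast
qed

text \<open>Boundedness of \<open>v\<close> makes the convergence uniform enough in \<open>w\<close> to pass to limits.  It
  allows weak convergence to be tested on a spanning set only.\<close>

lemma closed_subspace_tested_null:
  fixes v :: "nat \<Rightarrow> 'a::real_inner"
  assumes "\<And>n. norm (v n) \<le> B"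
  shows "subspace {w. (\<lambda>n. inner w (v n)) \<longlonglongrightarrow> 0}" (is "subspace ?M")
    and "closed {w. (\<lambda>n. inner w (v n)) \<longlonglongrightarrow> 0}"
proof -
  show "subspace ?M"
    by (auto simp: subspace_def inner_add_left tendsto_add_zero tendsto_mult_right_zero)
  have B0: "0 \<le> B"
    using assms[of 0] norm_ge_zero order_trans by blast
  have "w \<in> ?M" if "w \<in> closure ?M" for w
  proof -
    have "eventually (\<lambda>n. \<bar>inner w (v n)\<bar> < e) sequentially" if "e > 0" for e
    proof -
      from \<open>w \<in> closure ?M\<close> obtain w' where w': "w' \<in> ?M" "dist w' w < e / (2 * (B + 1))"
        using B0 \<open>e > 0\<close> unfolding closure_approachable
        by (metis add_nonneg_pos divide_pos_pos mult_pos_pos zero_less_numeral zero_less_one)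
      have "eventually (\<lambda>n. \<bar>inner w' (v n)\<bar> < e / 2) sequentially"
        using w'(1) \<open>e > 0\<close> by (auto simp: tendsto_iff dist_real_def elim!: allE[of _ "e / 2"])
      then show ?thesis
      proof eventually_elim
        case (elim n)
        have "\<bar>inner (w - w') (v n)\<bar> \<le> norm (w - w') * norm (v n)"
          by (rule Cauchy_Schwarz_ineq2)
        also have "\<dots> \<le> e / (2 * (B + 1)) * (B + 1)"
          using w'(2) assms[of n] B0 \<open>e > 0\<close>
          by (intro mult_mono) (auto simp: dist_norm norm_minus_commute)
        also have "\<dots> = e / 2" using B0 by (simp add: field_simps)
        finally show ?case
          using elim unfolding inner_diff_left by linarith
      qed
    qed
    then show ?thesis by (simp add: tendsto_iff dist_real_def)
  qed
  then show "closed ?M"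
    by (metis closure_subset closure_eq subsetI subset_antisym)
qed

text \<open>Choose the subsequence \<open>v\<close> so that its inner products with each \<open>s k\<close> converge, and let \<open>p\<close> be a
  common point of the closed convex hulls \<open>K k\<close> of its tails.  Whenever \<open>\<langle>w, v n\<rangle>\<close> converges,
  the limit must be \<open>\<langle>w, p\<rangle>\<close>, since late tails, and with them \<open>p\<close>, lie in a thin slab.
  The vectors \<open>w\<close> that test correctly form a closed subspace \<open>M\<close> containing all \<open>v n\<close> and \<open>p\<close>; the part
  of \<open>z\<close> orthogonal to \<open>M\<close> does not see \<open>v n - p\<close> at all.\<close>

lemma bounded_imp_weakly_convergent_subsequence:
  fixes s :: "nat \<Rightarrow> 'a::{real_inner, complete_space}"
  assumes "bounded (range s)"
  shows "\<exists>r p. strict_mono r \<and> weakly_converges (s \<circ> r) p"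
proof -
  obtain B where B: "\<And>n. norm (s n) \<le> B"
    using assms by (auto simp: bounded_iff)
  have "\<bar>inner (s k) (s n)\<bar> \<le> norm (s k) * B" for k n
    using Cauchy_Schwarz_ineq2[of "s k" "s n"] mult_left_mono[OF B[of n], of "norm (s k)"] by simp
  then obtain r where r: "strict_mono r" "\<And>k. convergent (\<lambda>n. inner (s k) (s (r n)))"
    using bounded_real_diagonal_subsequence[of "\<lambda>n k. inner (s k) (s n)" "\<lambda>k. norm (s k) * B"] by auto
  define v where "v n = s (r n)" for n
  have vB: "norm (v n) \<le> B" for n
    unfolding v_def by (rule B)
  define K where "K k = closure (convex hull (v ` {k..}))" for k
  have "\<exists>p. \<forall>k. p \<in> K k \<and> dist 0 p \<le> (SUP k. infdist 0 (K k))"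
  proof (rule nested_closed_convex_meet)
    show "closed (K k)" "convex (K k)" "K k \<noteq> {}" for k
      unfolding K_def by (auto simp: convex_closure convex_convex_hull)
    show "K l \<subseteq> K k" if "k \<le> l" for k l
      unfolding K_def using that by (intro closure_mono hull_mono) auto
    show "infdist 0 (K k) \<le> B" for k
    proof -
      have "v k \<in> K k"
        unfolding K_def by (intro subsetD[OF closure_subset] hull_inc) auto
      then have "infdist 0 (K k) \<le> dist 0 (v k)" by (rule infdist_le)
      then show ?thesis using vB[of k] by simp
    qed
  qed
  then obtain p where p: "\<And>k. p \<in> K k" by blast
  have K_least: "K k \<subseteq> A" if "closed A" "convex A" "\<And>n. n \<ge> k \<Longrightarrow> v n \<in> A" for k A
    unfolding K_def using that by (intro closure_minimal hull_minimal) auto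
  have limit_at_p: "(\<lambda>n. inner w (v n)) \<longlonglongrightarrow> inner w p" if "(\<lambda>n. inner w (v n)) \<longlonglongrightarrow> L" for w L
  proof -
    have "dist (inner w p) L \<le> e" if "e > 0" for e
    proof -
      from \<open>(\<lambda>n. inner w (v n)) \<longlonglongrightarrow> L\<close> that
      obtain k where k: "\<And>n. n \<ge> k \<Longrightarrow> dist (inner w (v n)) L < e"
        unfolding lim_sequentially by blast
      have "K k \<subseteq> {z. inner w z \<le> L + e} \<inter> {z. inner (- w) z \<le> e - L}"
        using k by (intro K_least closed_Int convex_Int closed_halfspace_le convex_halfspace_le)
          (auto simp: dist_real_def abs_less_iff intro!: less_imp_le dest!: k)
      with p[of k] show ?thesis by (auto simp: dist_real_def abs_le_iff)
    qed
    then have "inner w p = L"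
      by (metis dist_eq_0_iff dist_pos_lt dense not_le zero_less_dist_iff)
    with that show ?thesis by simp
  qed
  \<comment> \<open>testing against \<open>v n - p\<close> instead of \<open>v n\<close> makes the limits zero, so that \<open>M\<close> is a subspace\<close>
  define M where "M = {w. (\<lambda>n. inner w (v n - p)) \<longlonglongrightarrow> 0}"
  have vp: "norm (v n - p) \<le> B + norm p" for n
    using norm_triangle_ineq4[of "v n" p] vB[of n] by linarith
  have subM: "subspace M" and clM: "closed M"
    unfolding M_def by (rule closed_subspace_tested_null[OF vp])+
  have vM: "v n \<in> M" for n
  proof -
    have "convergent (\<lambda>j. inner (v n) (v j))"
      using r(2)[of "r n"] by (simp add: v_def)
    then have "(\<lambda>j. inner (v n) (v j)) \<longlonglongrightarrow> inner (v n) p"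
      using limit_at_p unfolding convergent_def by blast
    then show ?thesis
      unfolding M_def by (simp add: inner_diff_right LIM_zero)
  qed
  have pM: "p \<in> M"
    using K_least[OF clM subspace_imp_convex[OF subM], of 0] vM p by blast
  have "(\<lambda>n. inner z (v n)) \<longlonglongrightarrow> inner z p" for z
  proof -
    obtain q where q: "q \<in> M" "\<And>w. w \<in> M \<Longrightarrow> inner (z - q) (w - q) \<le> 0"
      using projection_on_closed_convex[OF clM subspace_imp_convex[OF subM], of z] vM by blast
    have orth: "inner (z - q) w = 0" if "w \<in> M" for w
    proof -
      have "inner (z - q) w \<le> 0"
        using q(2)[of "q + w"] subspace_add[OF subM q(1) that] by simp
      moreover have "inner (z - q) (- w) \<le> 0"
        using q(2)[of "q - w"] subspace_diff[OF subM q(1) that] by simp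
      ultimately show ?thesis by simp
    qed
    have "inner z (v n - p) = inner q (v n - p)" for n
      using orth[OF subspace_diff[OF subM vM pM], of n] by (simp add: inner_diff_left)
    with q(1) have "(\<lambda>n. inner z (v n - p)) \<longlonglongrightarrow> 0"
      unfolding M_def by simp
    then show ?thesis
      by (simp add: inner_diff_right LIM_zero_iff)
  qed
  with r(1) show ?thesis
    unfolding weakly_converges_def v_def o_def by blast
qed

section \<open>Cutters\<close>

text \<open>The cutter inequality puts the fixed points in the half-spaces.  Conversely, for a point \<open>z\<close> of all
  of them, the half-space belonging to \<open>x = z\<close> says that \<open>\<parallel>z - T z\<parallel>\<^sup>2 \<le> 0\<close>.\<close>

lemma cutter_Fix_halfspaces:
  assumes "cutter T"
  shows "Fix T = (\<Inter>x. {z. inner (x - T x) z \<le> inner (x - T x) (T x)})" (is "_ = ?H")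
proof
  show "Fix T \<subseteq> ?H"
    using assms by (auto simp: cutter_def inner_diff_right)
  show "?H \<subseteq> Fix T"
  proof
    fix z assume "z \<in> ?H"
    then have "inner (z - T z) (z - T z) \<le> 0"
      by (simp add: inner_diff_right)
    then show "z \<in> Fix T"
      using inner_ge_zero[of "z - T z"] by (simp add: Fix_def order_antisym)
  qed
qed

lemma cutter_Fix_closed_convex:
  assumes "cutter T"
  shows "closed (Fix T)" "convex (Fix T)"
  unfolding cutter_Fix_halfspaces[OF assms]
  by (intro closed_INT ballI closed_halfspace_le)
    (intro convex_INT convex_halfspace_le)

lemma cutter_dist_decrease:
  assumes "cutter T" "z \<in> Fix T"
  shows "(norm (T x - z))\<^sup>2 \<le> (norm (x - z))\<^sup>2 - (norm (T x - x))\<^sup>2"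
proof -
  have "inner (x - T x) (z - T x) \<le> 0"
    using assms by (auto simp: cutter_def)
  then show ?thesis
    unfolding power2_norm_eq_inner
    by (simp add: inner_diff_left inner_diff_right inner_commute algebra_simps)
qed

section \<open>Strongly monotone variational inequalities\<close>

lemma strongly_monotone_vi_solution_unique:
  assumes "strongly_monotone \<eta> F" "vi_solution F C u" "vi_solution F C v"
  shows "v = u"
proof -
  have "inner (F u) (v - u) \<ge> 0" "inner (F v) (u - v) \<ge> 0"
    using assms(2,3) by (auto simp: vi_solution_def)
  then have "inner (F u - F v) (u - v) \<le> 0"
    by (simp add: inner_diff_left inner_diff_right)
  with assms(1) have "\<eta> > 0" "\<eta> * (norm (u - v))\<^sup>2 \<le> 0"
    unfolding strongly_monotone_def by (auto intro: order_trans)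
  then show ?thesis
    by (simp add: mult_le_0_iff)
qed

text \<open>Expanding the square gives the factor \<open>1 - 2 t \<eta> + t\<^sup>2 \<kappa>\<^sup>2\<close>, which is smallest at \<open>t = \<eta> / \<kappa>\<^sup>2\<close>.
  The maximum with zero covers the trivial space, where \<open>\<eta>\<close> may exceed \<open>\<kappa>\<close>.\<close>

lemma strongly_monotone_gradient_step_contraction:
  fixes F :: "'a::real_inner \<Rightarrow> 'a"
  assumes F: "strongly_monotone \<eta> F" and L: "\<kappa>-lipschitz_on UNIV F" and "\<kappa> > 0"
  shows "\<exists>t c. 0 < t \<and> 0 \<le> c \<and> c < 1 \<and>
    (\<forall>v w. norm ((v - t *\<^sub>R F v) - (w - t *\<^sub>R F w)) \<le> c * norm (v - w))"
proof -
  have \<eta>: "\<eta> > 0" and mono: "\<And>v w. \<eta> * (norm (v - w))\<^sup>2 \<le> inner (F v - F w) (v - w)"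
    using F by (auto simp: strongly_monotone_def)
  define t where "t = \<eta> / \<kappa>\<^sup>2"
  define q where "q = max 0 (1 - \<eta>\<^sup>2 / \<kappa>\<^sup>2)"
  have t: "t > 0" unfolding t_def using \<eta> \<open>\<kappa> > 0\<close> by simp
  have q: "0 \<le> q" "q < 1" unfolding q_def using \<eta> \<open>\<kappa> > 0\<close> by auto
  have "norm ((v - t *\<^sub>R F v) - (w - t *\<^sub>R F w)) \<le> sqrt q * norm (v - w)" for v w
  proof -
    have "norm (F v - F w) \<le> \<kappa> * norm (v - w)"
      using lipschitz_onD[OF L, of v w] by (simp add: dist_norm)
    then have "(norm (F v - F w))\<^sup>2 \<le> (\<kappa> * norm (v - w))\<^sup>2"
      by (intro power_mono) auto
    then have lip: "t\<^sup>2 * (norm (F v - F w))\<^sup>2 \<le> t\<^sup>2 * (\<kappa>\<^sup>2 * (norm (v - w))\<^sup>2)"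
      by (intro mult_left_mono) (auto simp: power_mult_distrib)
    have "(norm ((v - t *\<^sub>R F v) - (w - t *\<^sub>R F w)))\<^sup>2
        = (norm (v - w))\<^sup>2 - 2 * t * inner (F v - F w) (v - w) + t\<^sup>2 * (norm (F v - F w))\<^sup>2"
      unfolding power2_norm_eq_inner
      by (simp add: inner_diff_left inner_diff_right inner_commute algebra_simps power2_eq_square)
    also have "\<dots> \<le> (norm (v - w))\<^sup>2 - 2 * t * (\<eta> * (norm (v - w))\<^sup>2)
        + t\<^sup>2 * (\<kappa>\<^sup>2 * (norm (v - w))\<^sup>2)"
      using lip mult_left_mono[OF mono[of v w], of "2 * t"] t by linarith
    also have "\<dots> = (1 - \<eta>\<^sup>2 / \<kappa>\<^sup>2) * (norm (v - w))\<^sup>2"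
      unfolding t_def using \<open>\<kappa> > 0\<close> by (simp add: field_simps power2_eq_square)
    also have "\<dots> \<le> q * (norm (v - w))\<^sup>2"
      unfolding q_def by (intro mult_right_mono) auto
    also have "\<dots> = (sqrt q * norm (v - w))\<^sup>2"
      using q by (simp add: power_mult_distrib)
    finally show ?thesis
      by (rule power2_le_imp_le) (use q in auto)
  qed
  with t q show ?thesis
    by (intro exI[of _ t] exI[of _ "sqrt q"]) auto
qed

text \<open>Projections are nonexpansive: add the obtuse-angle inequalities of \<open>p\<close> and \<open>p'\<close>, each tested at the
  other point.\<close>

lemma projection_norm_le:
  fixes p p' :: "'a::real_inner"
  assumes "\<And>z. z \<in> C \<Longrightarrow> inner (a - p) (z - p) \<le> 0" "p \<in> C"
    and "\<And>z. z \<in> C \<Longrightarrow> inner (a' - p') (z - p') \<le> 0" "p' \<in> C"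
  shows "norm (p - p') \<le> norm (a - a')"
proof -
  have "inner (a - p) (p' - p) \<le> 0" "inner (a' - p') (p - p') \<le> 0"
    using assms by auto
  then have "norm (p - p') * norm (p - p') \<le> inner (a - a') (p - p')"
    unfolding power2_eq_square[symmetric] power2_norm_eq_inner
    by (simp add: inner_diff_left inner_diff_right inner_commute)
  also have "\<dots> \<le> norm (a - a') * norm (p - p')"
    by (rule norm_cauchy_schwarz)
  finally show ?thesis
    by (metis mult_right_le_imp_le norm_ge_zero order_le_less)
qed

text \<open>Solutions are the fixed points of the contraction \<open>v \<mapsto> P (v - t F v)\<close>, with \<open>P\<close> the
  projection on \<open>C\<close>.\<close>

lemma strongly_monotone_vi_solution_exists:
  fixes F :: "'a::{real_inner, complete_space} \<Rightarrow> 'a"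
  assumes F: "strongly_monotone \<eta> F" "\<kappa>-lipschitz_on UNIV F" "\<kappa> > 0"
    and C: "closed C" "convex C" "C \<noteq> {}"
  shows "\<exists>u. vi_solution F C u"
proof -
  obtain t c where t: "t > 0" and c: "0 \<le> c" "c < 1"
    and contr: "\<And>v w. norm ((v - t *\<^sub>R F v) - (w - t *\<^sub>R F w)) \<le> c * norm (v - w)"
    using strongly_monotone_gradient_step_contraction[OF F] by blast
  obtain P where P: "\<And>a. P a \<in> C" "\<And>a z. z \<in> C \<Longrightarrow> inner (a - P a) (z - P a) \<le> 0"
    using projection_on_closed_convex[OF C] by metis
  have "dist (P (v - t *\<^sub>R F v)) (P (w - t *\<^sub>R F w)) \<le> c * dist v w" for v w
  proof -
    have "norm (P (v - t *\<^sub>R F v) - P (w - t *\<^sub>R F w)) \<le> norm ((v - t *\<^sub>R F v) - (w - t *\<^sub>R F w))"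
      by (rule projection_norm_le[where C = C]) (auto intro: P)
    with contr[of v w] show ?thesis
      unfolding dist_norm by linarith
  qed
  then obtain u where u: "P (u - t *\<^sub>R F u) = u"
    using banach_fix_type[OF c, of "\<lambda>v. P (v - t *\<^sub>R F v)"] by auto
  have "inner (F u) (z - u) \<ge> 0" if "z \<in> C" for z
    using P(2)[OF that, of "u - t *\<^sub>R F u"] t unfolding u by (simp add: zero_le_mult_iff)
  moreover have "u \<in> C"
    using P(1)[of "u - t *\<^sub>R F u"] unfolding u .
  ultimately show ?thesis
    unfolding vi_solution_def by blast
qed

section \<open>Extrapolated steps for compositions of cutters\<close>

text \<open>Both the guaranteed gain of an extrapolated step and the quantity whose vanishing feeds the
  demi-closedness of each single \<open>T i\<close>.\<close>

definition comp_residual :: "(nat \<Rightarrow> 'a::real_inner \<Rightarrow> 'a) \<Rightarrow> nat \<Rightarrow> 'a \<Rightarrow> real" where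
  "comp_residual T m y = (\<Sum>i=1..m. (norm (partial_comp T i y - partial_comp T (i - 1) y))\<^sup>2)"

lemma comp_residual_nonneg: "0 \<le> comp_residual T m y"
  unfolding comp_residual_def by (intro sum_nonneg) auto

lemma partial_comp_fixed:
  assumes "\<And>i. i \<in> {1..m} \<Longrightarrow> y \<in> Fix (T i)" "i \<le> m"
  shows "partial_comp T i y = y"
  using assms(2) by (induction i) (use assms(1) in \<open>auto simp: Fix_def\<close>)

lemma comp_residual_eq_0_imp_fixed:
  assumes "comp_residual T m y = 0" "i \<in> {1..m}"
  shows "y \<in> Fix (T i)"
proof -
  have step: "partial_comp T (Suc j) y = partial_comp T j y" if "j < m" for j
  proof -
    have "\<forall>i\<in>{1..m}. (norm (partial_comp T i y - partial_comp T (i - 1) y))\<^sup>2 = 0"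
      using assms(1) unfolding comp_residual_def by (subst (asm) sum_nonneg_eq_0_iff) auto
    then show ?thesis using that by (auto dest!: bspec[of _ _ "Suc j"])
  qed
  have "partial_comp T j y = y" if "j \<le> m" for j
    using that
  proof (induction j)
    case (Suc j)
    then show ?case using step[of j] by simp
  qed simp
  from this[of "i - 1"] step[of "i - 1"] assms(2) show ?thesis
    by (cases i) (auto simp: Fix_def)
qed

text \<open>Polarization turns each summand into \<open>\<parallel>u\<^sub>i - u\<^sub>i\<^sub>-\<^sub>1\<parallel>\<^sup>2\<close> plus a difference of consecutive
  squared distances to \<open>u\<^sub>m\<close>, and these differences telescope.\<close>

lemma step_size_numerator:
  "(\<Sum>i=1..m. inner (partial_comp T m y - partial_comp T (i - 1) y)
                    (partial_comp T i y - partial_comp T (i - 1) y))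
   = (comp_residual T m y + (norm (partial_comp T m y - y))\<^sup>2) / 2"
proof -
  let ?u = "\<lambda>i. partial_comp T i y"
  have "2 * inner (w - ?u (i - 1)) (?u i - ?u (i - 1))
      = (norm (?u i - ?u (i - 1)))\<^sup>2 + ((norm (w - ?u (i - 1)))\<^sup>2 - (norm (w - ?u i))\<^sup>2)" for i w
    unfolding power2_norm_eq_inner
    by (simp add: inner_diff_left inner_diff_right inner_commute)
  then have "2 * (\<Sum>i=1..k. inner (w - ?u (i - 1)) (?u i - ?u (i - 1)))
      = comp_residual T k y + (\<Sum>i=1..k. (norm (w - ?u (i - 1)))\<^sup>2 - (norm (w - ?u i))\<^sup>2)" for k w
    unfolding comp_residual_def by (simp add: sum_distrib_left sum.distrib)
  moreover have "(\<Sum>i=1..k. (norm (w - ?u (i - 1)))\<^sup>2 - (norm (w - ?u i))\<^sup>2)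
      = (norm (w - y))\<^sup>2 - (norm (w - ?u k))\<^sup>2" for k w
    by (induction k) auto
  ultimately have "2 * (\<Sum>i=1..m. inner (?u m - ?u (i - 1)) (?u i - ?u (i - 1)))
      = comp_residual T m y + ((norm (?u m - y))\<^sup>2 - (norm (?u m - ?u m))\<^sup>2)"
    by (simp only:)
  then show ?thesis by simp
qed

lemma partial_comp_dist_decrease:
  assumes "\<And>i. i \<in> {1..m} \<Longrightarrow> cutter (T i)" "\<And>i. i \<in> {1..m} \<Longrightarrow> z \<in> Fix (T i)"
  shows "(norm (partial_comp T m y - z))\<^sup>2 \<le> (norm (y - z))\<^sup>2 - comp_residual T m y"
  using assms
proof (induction m)
  case 0
  then show ?case by (simp add: comp_residual_def)
next
  case (Suc m)
  have "(norm (partial_comp T m y - z))\<^sup>2 \<le> (norm (y - z))\<^sup>2 - comp_residual T m y"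
    using Suc by auto
  with cutter_dist_decrease[of "T (Suc m)" z "partial_comp T m y"] Suc.prems
  show ?case by (simp add: comp_residual_def)
qed

text \<open>With \<open>g = T y - y\<close> and \<open>N\<close> the numerator of \<open>\<sigma>\<close>, the Fejer inequality for the chain says
  \<open>N \<le> \<langle>g, z - y\<rangle>\<close>, while \<open>\<sigma> \<parallel>g\<parallel>\<^sup>2 = N\<close>.  Hence the squared distance drops by at least
  \<open>l (2 - l) \<sigma> N\<close>, where \<open>\<sigma> \<ge> 1/2\<close> and \<open>N\<close> is at least half of the residual.  The same inequality
  shows that \<open>g\<close> vanishes only at common fixed points, so the division in \<open>\<sigma>\<close> is a real one.\<close>

lemma extrapolated_step_dist_decrease:
  fixes T :: "nat \<Rightarrow> 'a::real_inner \<Rightarrow> 'a"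
  assumes cut: "\<And>i. i \<in> {1..m} \<Longrightarrow> cutter (T i)"
    and z: "\<And>i. i \<in> {1..m} \<Longrightarrow> z \<in> Fix (T i)"
    and l: "eps \<le> l" "l \<le> 2 - eps" and eps: "0 < eps" "eps < 1"
  shows "(norm (y + (l * step_size m T y) *\<^sub>R (partial_comp T m y - y) - z))\<^sup>2
    \<le> (norm (y - z))\<^sup>2 - eps\<^sup>2 / 4 * comp_residual T m y"
proof (cases "y \<in> (\<Inter>i\<in>{1..m}. Fix (T i))")
  case True
  then have *: "partial_comp T i y = y" if "i \<le> m" for i
    using partial_comp_fixed[of m y T i] that by auto
  then have "comp_residual T m y = 0"
    unfolding comp_residual_def by (intro sum.neutral) auto
  with *[of m] show ?thesis by simp
next
  case False
  define g where "g = partial_comp T m y - y"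
  define R where "R = comp_residual T m y"
  define N where "N = (R + (norm g)\<^sup>2) / 2"
  define \<sigma> where "\<sigma> = step_size m T y"
  have "2 * inner g (z - y) = (norm g)\<^sup>2 + (norm (y - z))\<^sup>2 - (norm (partial_comp T m y - z))\<^sup>2"
    unfolding g_def power2_norm_eq_inner
    by (simp add: inner_diff_left inner_diff_right inner_commute)
  with partial_comp_dist_decrease[of m T z y] cut z
  have N_le: "N \<le> inner g (z - y)"
    unfolding N_def R_def by auto
  have R0: "R > 0"
    using False comp_residual_eq_0_imp_fixed[of T m y] comp_residual_nonneg[of T m y]
    unfolding R_def by (auto simp: less_le)
  have g0: "g \<noteq> 0"
    using N_le R0 by (auto simp: N_def)
  have \<sigma>: "\<sigma> * (norm g)\<^sup>2 = N"
    unfolding \<sigma>_def step_size_def step_size_numerator using False g0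
    by (simp add: N_def R_def g_def)
  have half: "1 / 2 \<le> \<sigma>"
  proof -
    have "1 / 2 * (norm g)\<^sup>2 \<le> \<sigma> * (norm g)\<^sup>2"
      unfolding \<sigma> N_def using R0 by simp
    then show ?thesis using g0 by (subst (asm) mult_le_cancel_right) auto
  qed
  have "(norm (y + (l * \<sigma>) *\<^sub>R g - z))\<^sup>2
      = (norm (y - z))\<^sup>2 - 2 * (l * \<sigma>) * inner g (z - y) + (l * \<sigma>)\<^sup>2 * (norm g)\<^sup>2"
    unfolding power2_norm_eq_inner
    by (simp add: inner_diff_left inner_diff_right inner_add_left inner_add_right inner_commute
        algebra_simps power2_eq_square)
  also have "\<dots> = (norm (y - z))\<^sup>2 - 2 * (l * \<sigma>) * inner g (z - y) + l\<^sup>2 * \<sigma> * N"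
    unfolding \<sigma>[symmetric] by (simp add: power2_eq_square)
  also have "\<dots> \<le> (norm (y - z))\<^sup>2 - 2 * (l * \<sigma>) * N + l\<^sup>2 * \<sigma> * N"
    using mult_left_mono[OF N_le, of "2 * (l * \<sigma>)"] half l eps by simp
  also have "\<dots> = (norm (y - z))\<^sup>2 - (l * (2 - l)) * (\<sigma> * N)"
    by (simp add: algebra_simps power2_eq_square)
  also have "\<dots> \<le> (norm (y - z))\<^sup>2 - eps\<^sup>2 * (R / 4)"
  proof -
    have "eps\<^sup>2 \<le> l * (2 - l)"
      unfolding power2_eq_square using l eps by (intro mult_mono) auto
    moreover have "R / 4 \<le> \<sigma> * N"
      using mult_mono[OF half, of "R / 2" N] R0 half by (auto simp: N_def)
    ultimately have "eps\<^sup>2 * (R / 4) \<le> (l * (2 - l)) * (\<sigma> * N)"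
      using R0 l eps by (intro mult_mono) auto
    then show ?thesis by simp
  qed
  finally show ?thesis by (simp add: g_def R_def \<sigma>_def)
qed

section \<open>Perturbed descent recursions\<close>

text \<open>As long as \<open>t\<close> stays above \<open>e\<close>, step \<open>n\<close> subtracts at least \<open>e \<gamma> n\<close>, which the divergent sum does not
  permit forever; once below \<open>e\<close>, the sequence cannot climb back.\<close>

lemma damped_sequence_eventually_le:
  fixes t \<gamma> :: "nat \<Rightarrow> real"
  assumes rec: "eventually (\<lambda>n. t (Suc n) \<le> (1 - \<gamma> n) * t n) sequentially"
    and \<gamma>: "eventually (\<lambda>n. 0 \<le> \<gamma> n \<and> \<gamma> n \<le> 1) sequentially"
    and div: "filterlim (\<lambda>n. \<Sum>i=1..n. \<gamma> i) at_top at_top"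
    and e: "e > 0"
  shows "eventually (\<lambda>n. t n \<le> e) sequentially"
proof -
  obtain N where N: "\<And>n. n \<ge> N \<Longrightarrow> t (Suc n) \<le> (1 - \<gamma> n) * t n"
    "\<And>n. n \<ge> N \<Longrightarrow> 0 \<le> \<gamma> n" "\<And>n. n \<ge> N \<Longrightarrow> \<gamma> n \<le> 1"
    using eventually_conj[OF rec \<gamma>] unfolding eventually_sequentially by auto
  have "\<exists>n0\<ge>N. t n0 \<le> e"
  proof (rule ccontr)
    assume "\<not> ?thesis"
    then have big: "t n > e" if "n \<ge> N" for n using that by force
    define G where "G n = (\<Sum>i=1..n. \<gamma> i)" for n
    have bound: "t (Suc n) + e * G n \<le> t N + e * G N" if "n \<ge> N" for n
      using that
    proof (induction n rule: dec_induct)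
      case base
      have "0 \<le> \<gamma> N * t N"
        using N(2)[of N] big[of N] e by simp
      with N(1)[of N] show ?case by (simp add: algebra_simps)
    next
      case (step n)
      have "\<gamma> (Suc n) * e \<le> \<gamma> (Suc n) * t (Suc n)"
        using N(2)[of "Suc n"] big[of "Suc n"] step by (intro mult_left_mono) auto
      with N(1)[of "Suc n"] step show ?case
        by (simp add: G_def algebra_simps)
    qed
    have "eventually (\<lambda>n. G n > (t N + e * G N) / e) sequentially"
      using div unfolding G_def filterlim_at_top_dense by blast
    with eventually_ge_at_top[of N] have "eventually (\<lambda>n. n \<ge> N \<and> G n > (t N + e * G N) / e) sequentially"
      by eventually_elim auto
    then obtain n where n: "n \<ge> N" "G n > (t N + e * G N) / e"
      unfolding eventually_sequentially by blast
    have "e * G n > t N + e * G N"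
      using n(2) e by (simp add: field_simps)
    with bound[OF n(1)] big[of "Suc n"] n(1) e show False by auto
  qed
  then obtain n0 where n0: "n0 \<ge> N" "t n0 \<le> e" by blast
  have "t n \<le> e" if "n \<ge> n0" for n
    using that
  proof (induction n rule: dec_induct)
    case base
    then show ?case by (rule n0(2))
  next
    case (step n)
    have n: "n \<ge> N" using step n0 by simp
    have "(1 - \<gamma> n) * t n \<le> (1 - \<gamma> n) * e"
      using N(3)[OF n] step by (intro mult_left_mono) auto
    also have "\<dots> \<le> e"
      using N(2)[OF n] e by (simp add: algebra_simps)
    finally show ?case using N(1)[OF n] by linarith
  qed
  then show ?thesis
    unfolding eventually_sequentially by blast
qed

text \<open>A subsequence with vanishing \<open>A\<close> and \<open>b > e\<close> could be chosen otherwise.  This turns the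
  information on subsequences into a bound for all late indices.\<close>

lemma residual_controls_perturbation:
  fixes A b :: "nat \<Rightarrow> real"
  assumes A0: "\<And>n. 0 \<le> A n"
    and cluster: "\<And>r. strict_mono r \<Longrightarrow> (\<lambda>k. A (r k)) \<longlonglongrightarrow> 0 \<Longrightarrow> \<exists>k. b (r k) \<le> e"
  shows "\<exists>\<delta>>0. eventually (\<lambda>n. A n \<le> \<delta> \<longrightarrow> b n \<le> e) sequentially"
proof (rule ccontr)
  assume contra: "\<not> ?thesis"
  have ex: "\<exists>n\<ge>M. A n \<le> inverse (real (Suc k)) \<and> e < b n" for k M
    using contra unfolding eventually_sequentially
    by (metis inverse_positive_iff_positive not_le of_nat_0_less_iff zero_less_Suc)
  have "\<exists>r. \<forall>k. (A (r k) \<le> inverse (real (Suc k)) \<and> e < b (r k)) \<and> r k < r (Suc k)"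
  proof (rule dependent_nat_choice[where P = "\<lambda>k n. A n \<le> inverse (real (Suc k)) \<and> e < b n"
        and Q = "\<lambda>_ n n'. n < n'"])
    show "\<exists>n. A n \<le> inverse (real (Suc 0)) \<and> e < b n"
      using ex by blast
    show "\<exists>n'. (A n' \<le> inverse (real (Suc (Suc k))) \<and> e < b n') \<and> n < n'" for n k
      using ex[of "Suc n" "Suc k"] Suc_le_eq by blast
  qed
  then obtain r where r: "\<And>k. A (r k) \<le> inverse (real (Suc k))" "\<And>k. e < b (r k)"
    "strict_mono r"
    by (auto simp: strict_mono_Suc_iff)
  have "(\<lambda>k. A (r k)) \<longlonglongrightarrow> 0"
    by (rule tendsto_sandwich[OF _ _ tendsto_const LIMSEQ_inverse_real_of_nat])
      (intro always_eventually allI A0 r(1))+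
  from cluster[OF r(3) this] r(2) show False
    by (auto simp: not_less[symmetric])
qed

text \<open>For a target \<open>e\<close> put \<open>K = e / 2\<close>.  When \<open>A n\<close> is small, \<open>b n \<le> g K\<close>; when it is not, \<open>A n\<close> absorbs the
  vanishing term \<open>\<beta> n B\<close>.  Either way \<open>s - K\<close> is damped by the factors \<open>1 - g \<beta> n\<close>.\<close>

lemma perturbed_descent_tendsto_0:
  fixes s A b \<beta> :: "nat \<Rightarrow> real"
  assumes rec: "eventually (\<lambda>n. s (Suc n) \<le> (1 - g * \<beta> n) * s n + \<beta> n * b n - A n) sequentially"
    and s0: "\<And>n. 0 \<le> s n" and A0: "\<And>n. 0 \<le> A n"
    and g: "g > 0"
    and \<beta>0: "eventually (\<lambda>n. 0 \<le> \<beta> n) sequentially" and \<beta>: "\<beta> \<longlonglongrightarrow> 0"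
    and div: "filterlim (\<lambda>n. \<Sum>i=1..n. \<beta> i) at_top at_top"
    and bB: "eventually (\<lambda>n. b n \<le> B) sequentially"
    and cluster: "\<And>r e. strict_mono r \<Longrightarrow> (\<lambda>k. A (r k)) \<longlonglongrightarrow> 0 \<Longrightarrow> e > 0 \<Longrightarrow> \<exists>k. b (r k) \<le> e"
  shows "s \<longlonglongrightarrow> 0"
proof -
  have upper: "eventually (\<lambda>n. s n < e) sequentially" if e: "e > 0" for e
  proof -
    define K where "K = e / 2"
    have K: "K > 0" using e by (simp add: K_def)
    obtain \<delta> where \<delta>: "\<delta> > 0" "eventually (\<lambda>n. A n \<le> \<delta> \<longrightarrow> b n \<le> g * K) sequentially"
      using residual_controls_perturbation[where A = A and b = b and e = "g * K"] A0 cluster g K by auto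
    have "(\<lambda>n. \<beta> n * B) \<longlonglongrightarrow> 0"
      using \<beta> by (rule tendsto_mult_left_zero)
    then have small: "eventually (\<lambda>n. \<beta> n * B < \<delta>) sequentially"
      using \<delta>(1) by (rule order_tendstoD)
    have "(\<lambda>n. g * \<beta> n) \<longlonglongrightarrow> 0"
      using \<beta> by (rule tendsto_mult_right_zero)
    then have le1: "eventually (\<lambda>n. g * \<beta> n < 1) sequentially"
      by (rule order_tendstoD) simp
    \<comment> \<open>the fixed point of the damped recursion is subtracted to remove the constant perturbation\<close>
    have "eventually (\<lambda>n. s (Suc n) - K \<le> (1 - g * \<beta> n) * (s n - K)) sequentially"
      using rec \<beta>0 bB \<delta>(2) small
    proof eventually_elim
      case (elim n)
      have gK: "0 \<le> \<beta> n * (g * K)" using elim g K by simp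
      have "\<beta> n * b n - A n \<le> \<beta> n * (g * K)"
      proof (cases "A n \<le> \<delta>")
        case True
        then have "\<beta> n * b n \<le> \<beta> n * (g * K)"
          using elim by (intro mult_left_mono) auto
        with A0[of n] show ?thesis by linarith
      next
        case False
        have "\<beta> n * b n \<le> \<beta> n * B"
          using elim by (intro mult_left_mono) auto
        with False elim gK show ?thesis by linarith
      qed
      with elim show ?case by (simp add: algebra_simps)
    qed
    moreover have "eventually (\<lambda>n. 0 \<le> g * \<beta> n \<and> g * \<beta> n \<le> 1) sequentially"
      using \<beta>0 le1 by eventually_elim (use g in auto)
    moreover have "filterlim (\<lambda>n. \<Sum>i=1..n. g * \<beta> i) at_top at_top"
      unfolding sum_distrib_left[symmetric]
      by (rule filterlim_tendsto_pos_mult_at_top[OF tendsto_const g div])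
    ultimately have "eventually (\<lambda>n. s n - K \<le> K / 2) sequentially"
      using K by (intro damped_sequence_eventually_le[where \<gamma> = "\<lambda>n. g * \<beta> n"]) auto
    then show ?thesis
      by eventually_elim (use e in \<open>simp add: K_def\<close>)
  qed
  show ?thesis
    by (rule order_tendstoI) (auto intro!: always_eventually upper intro: less_le_trans s0)
qed

section \<open>Weak cluster points of the iteration\<close>

lemma weakly_converges_norm_close:
  assumes "weakly_converges s p" "(\<lambda>n. norm (t n - s n)) \<longlonglongrightarrow> 0"
  shows "weakly_converges t p"
  unfolding weakly_converges_def
proof
  fix z
  have "(\<lambda>n. t n - s n) \<longlonglongrightarrow> 0"
    using assms(2) by (simp add: tendsto_norm_zero_iff)
  from tendsto_add[OF _ tendsto_inner[OF tendsto_const this], of "\<lambda>n. inner z (s n)" "inner z p" z]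
  show "(\<lambda>n. inner z (t n)) \<longlonglongrightarrow> inner z p"
    using assms(1) by (simp add: weakly_converges_def inner_diff_right)
qed

text \<open>If the residual vanishes, all partial compositions \<open>S\<^sub>i y n\<close> share the weak limit \<open>p\<close>; demi-closedness
  of \<open>T\<^sub>i\<^sub>+\<^sub>1\<close> is applied to the sequence \<open>S\<^sub>i y n\<close>.\<close>

lemma weak_limit_in_common_Fix:
  fixes y :: "nat \<Rightarrow> 'a::real_inner"
  assumes dc: "\<And>i. i \<in> {1..m} \<Longrightarrow> demiclosed_principle (T i)"
    and y: "weakly_converges y p"
    and res: "(\<lambda>n. comp_residual T m (y n)) \<longlonglongrightarrow> 0"
  shows "p \<in> (\<Inter>i\<in>{1..m}. Fix (T i))"
proof -
  have step: "(\<lambda>n. norm (partial_comp T (Suc j) (y n) - partial_comp T j (y n))) \<longlonglongrightarrow> 0"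
    if "j < m" for j
  proof -
    have "(norm (partial_comp T (Suc j) v - partial_comp T j v))\<^sup>2 \<le> comp_residual T m v" for v
      unfolding comp_residual_def
      using member_le_sum[of "Suc j" "{1..m}"
          "\<lambda>i. (norm (partial_comp T i v - partial_comp T (i - 1) v))\<^sup>2"] that by simp
    then have "norm (partial_comp T (Suc j) v - partial_comp T j v) \<le> sqrt (comp_residual T m v)" for v
      by (intro real_le_rsqrt)
    then have "eventually (\<lambda>n. norm (norm (partial_comp T (Suc j) (y n) - partial_comp T j (y n)))
        \<le> sqrt (comp_residual T m (y n))) sequentially"
      by simp
    moreover have "(\<lambda>n. sqrt (comp_residual T m (y n))) \<longlonglongrightarrow> 0"
      using tendsto_real_sqrt[OF res] by simp
    ultimately show ?thesis
      by (rule Lim_null_comparison)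
  qed
  have weak: "weakly_converges (\<lambda>n. partial_comp T j (y n)) p" if "j \<le> m" for j
    using that
  proof (induction j)
    case 0
    then show ?case using y by simp
  next
    case (Suc j)
    then show ?case
      using weakly_converges_norm_close[OF _ step[of j]] by simp
  qed
  have "p \<in> Fix (T (Suc j))" if "j < m" for j
  proof -
    have "demiclosed_principle (T (Suc j))" using dc[of "Suc j"] that by simp
    with weak[of j] step[OF that] that have "T (Suc j) p = p"
      unfolding demiclosed_principle_def by auto
    then show ?thesis by (simp add: Fix_def)
  qed
  then show ?thesis
    by (auto simp: gr0_conv_Suc Suc_le_eq)
qed

section \<open>Convergence of the conjugate gradient iteration\<close>

lemma bounded_halving_recursion:
  fixes d :: "nat \<Rightarrow> real"
  assumes "eventually (\<lambda>n. d (Suc n) \<le> M + d n / 2) sequentially"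
  shows "\<exists>D. \<forall>n. d n \<le> D"
proof -
  obtain N where N: "\<And>n. n \<ge> N \<Longrightarrow> d (Suc n) \<le> M + d n / 2"
    using assms unfolding eventually_sequentially by blast
  \<comment> \<open>\<open>2 * M\<close> is the fixed point of \<open>t \<mapsto> M + t / 2\<close>, so larger upper bounds are preserved\<close>
  define D where "D = Max (insert (2 * M) (d ` {..N}))"
  have "d n \<le> D" for n
  proof (cases "n \<le> N")
    case True
    then show ?thesis unfolding D_def by (intro Max_ge) auto
  next
    case False
    then have "N \<le> n" by simp
    then show ?thesis
    proof (induction n rule: dec_induct)
      case base
      show ?case unfolding D_def by (intro Max_ge) auto
    next
      case (step n)
      have "2 * M \<le> D" unfolding D_def by (intro Max_ge) auto
      with N[of n] step show ?case by auto
    qed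
  qed
  then show ?thesis by blast
qed

text \<open>Eventually \<open>\<bar>\<phi>\<bar> \<le> 1/2\<close>, so that the norms satisfy a halving recursion with bounded input.\<close>

lemma conjugate_directions_bounded:
  fixes d f :: "nat \<Rightarrow> 'a::real_normed_vector"
  assumes rec: "\<And>n. n \<ge> 1 \<Longrightarrow> d (n + 1) = - f (n + 1) + \<phi> (n + 1) *\<^sub>R d n"
    and f: "\<And>n. n \<ge> 1 \<Longrightarrow> norm (f n) \<le> M"
    and \<phi>: "\<phi> \<longlonglongrightarrow> 0"
  shows "\<exists>D. \<forall>n. norm (d n) \<le> D"
proof -
  have "(\<lambda>n. \<bar>\<phi> (Suc n)\<bar>) \<longlonglongrightarrow> 0"
    using \<phi> by (intro tendsto_rabs_zero LIMSEQ_Suc)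
  then have "eventually (\<lambda>n. \<bar>\<phi> (Suc n)\<bar> < 1 / 2) sequentially"
    by (rule order_tendstoD) simp
  with eventually_ge_at_top[of 1]
  have "eventually (\<lambda>n. norm (d (Suc n)) \<le> M + norm (d n) / 2) sequentially"
  proof eventually_elim
    case (elim n)
    have "norm (d (Suc n)) \<le> norm (f (Suc n)) + \<bar>\<phi> (Suc n)\<bar> * norm (d n)"
      using rec[of n] norm_triangle_ineq[of "- f (Suc n)" "\<phi> (Suc n) *\<^sub>R d n"] elim by simp
    moreover have "\<bar>\<phi> (Suc n)\<bar> * norm (d n) \<le> 1 / 2 * norm (d n)"
      using elim by (intro mult_right_mono) auto
    ultimately show ?case using f[of "Suc n"] by simp
  qed
  then show ?thesis by (rule bounded_halving_recursion)
qed

lemma strongly_monotone_norm_le: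
  assumes "strongly_monotone \<eta> F"
  shows "norm (v - w) \<le> norm (F v - F w) / \<eta>"
proof -
  have \<eta>: "\<eta> > 0" using assms by (simp add: strongly_monotone_def)
  have "\<eta> * norm (v - w) * norm (v - w) \<le> inner (F v - F w) (v - w)"
    using assms by (simp add: strongly_monotone_def power2_eq_square mult.assoc)
  also have "\<dots> \<le> norm (F v - F w) * norm (v - w)"
    by (rule norm_cauchy_schwarz)
  finally have "\<eta> * norm (v - w) \<le> norm (F v - F w)"
    by (metis mult_right_le_imp_le norm_ge_zero norm_zero mult_zero_right order_le_less)
  then show ?thesis using \<eta> by (simp add: field_simps)
qed

text \<open>Boundedness of the \<open>F (x n)\<close> bounds \<open>x\<close> by strong monotonicity and \<open>d\<close> by the preceding recursion.
  The rest verifies the hypotheses of \<open>perturbed_descent_tendsto_0\<close> for the squared distances to \<open>u\<close>.\<close>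

lemma escom_cgd_tendsto_vi_solution:
  fixes T :: "nat \<Rightarrow> 'a::{real_inner, complete_space} \<Rightarrow> 'a"
  assumes m: "m \<ge> 1"
    and cut: "\<And>i. i \<in> {1..m} \<Longrightarrow> cutter (T i)"
    and F: "strongly_monotone \<eta> F"
    and \<mu>: "\<mu> > 0"
    and \<beta>0: "\<And>n. n \<ge> 1 \<Longrightarrow> \<beta> n \<ge> 0"
    and \<phi>0: "\<And>n. n \<ge> 1 \<Longrightarrow> \<phi> n \<ge> 0"
    and alg: "escom_cgd m T F \<mu> \<beta> \<phi> lam x y d"
    and \<beta>: "\<beta> \<longlonglongrightarrow> 0"
    and div: "filterlim (\<lambda>N. \<Sum>n=1..N. \<beta> n) at_top at_top"
    and \<phi>: "\<phi> \<longlonglongrightarrow> 0"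
    and eps: "eps \<in> {0<..<1}" and lam: "\<And>n. n \<ge> 1 \<Longrightarrow> lam n \<in> {eps..2 - eps}"
    and bnd: "bounded ((\<lambda>n. F (x n)) ` {1..})"
    and dc: "\<And>i. i \<in> {1..m} \<Longrightarrow> demiclosed_principle (T i)"
    and u: "vi_solution F (\<Inter>i\<in>{1..m}. Fix (T i)) u"
  shows "x \<longlonglongrightarrow> u"
proof -
  have \<eta>: "\<eta> > 0" using F by (simp add: strongly_monotone_def)
  have yrec: "y n = x n + (\<mu> * \<beta> n) *\<^sub>R d n"
    and xrec: "x (n + 1) = T m (y n + (lam n * step_size m T (y n)) *\<^sub>R (partial_comp T m (y n) - y n))"
    and drec: "d (n + 1) = - F (x (n + 1)) + \<phi> (n + 1) *\<^sub>R d n" if "n \<ge> 1" for n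
    using alg that unfolding escom_cgd_def by auto
  have uFix: "u \<in> Fix (T i)" if "i \<in> {1..m}" for i
    using u that by (auto simp: vi_solution_def)
  obtain M where M: "\<And>n. n \<ge> 1 \<Longrightarrow> norm (F (x n)) \<le> M"
    using bnd by (auto simp: bounded_iff)
  obtain D where D: "\<And>n. norm (d n) \<le> D"
    using conjugate_directions_bounded[of d "\<lambda>n. F (x n)" \<phi> M] drec M \<phi> by auto
  define R where "R = (M + norm (F u)) / \<eta>"
  have R: "norm (x n - u) \<le> R" if "n \<ge> 1" for n
  proof -
    have "norm (F (x n) - F u) \<le> M + norm (F u)"
      using M[OF that] norm_triangle_ineq4[of "F (x n)" "F u"] by linarith
    then have "norm (F (x n) - F u) / \<eta> \<le> R"
      unfolding R_def using \<eta> by (simp add: divide_right_mono)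
    with strongly_monotone_norm_le[OF F, of "x n" u] show ?thesis by linarith
  qed
  have D0: "0 \<le> D" using D[of 0] norm_ge_zero order_trans by blast
  have R0: "0 \<le> R" using R[of 1] norm_ge_zero order_trans by blast

  define s where "s n = (norm (x n - u))\<^sup>2" for n
  define A where "A n = eps\<^sup>2 / 4 * comp_residual T m (y n)" for n
  define b where
    "b n = 2 * \<mu> * (\<phi> n * (D * R) - inner (F u) (x n - u)) + \<mu>\<^sup>2 * \<beta> n * D\<^sup>2" for n
  define g where "g = 2 * \<mu> * \<eta>"

  \<comment> \<open>from 2 on, the direction \<open>d n\<close> has a predecessor produced by the iteration\<close>
  have descent: "s (Suc n) \<le> (1 - g * \<beta> n) * s n + \<beta> n * b n - A n" if "n \<ge> 2" for n
  proof -
    obtain k where k: "n = k + 1" "k \<ge> 1" using \<open>n \<ge> 2\<close> by (intro that[of "n - 1"]) auto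
    have n1: "n \<ge> 1" using \<open>n \<ge> 2\<close> by simp
    define v where "v = y n + (lam n * step_size m T (y n)) *\<^sub>R (partial_comp T m (y n) - y n)"
    have "cutter (T m)" "u \<in> Fix (T m)"
      using cut uFix m by auto
    from cutter_dist_decrease[OF this, of v]
    have "(norm (T m v - u))\<^sup>2 \<le> (norm (v - u))\<^sup>2"
      by (rule order_trans) simp
    also have "\<dots> \<le> (norm (y n - u))\<^sup>2 - A n"
      unfolding v_def A_def using extrapolated_step_dist_decrease[of m T u eps "lam n" "y n"]
        cut uFix lam[OF n1] eps by auto
    finally have 1: "s (Suc n) \<le> (norm (y n - u))\<^sup>2 - A n"
      using xrec[OF n1] by (simp add: s_def v_def)
    have dx: "inner (d n) (x n - u) \<le> - \<eta> * s n + (\<phi> n * (D * R) - inner (F u) (x n - u))"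
    proof -
      have "\<eta> * s n \<le> inner (F (x n) - F u) (x n - u)"
        using F by (simp add: s_def strongly_monotone_def)
      moreover have "inner (d k) (x n - u) \<le> D * R"
        using norm_cauchy_schwarz[of "d k" "x n - u"] mult_mono[OF D[of k] R[OF n1] D0] by simp
      then have "\<phi> n * inner (d k) (x n - u) \<le> \<phi> n * (D * R)"
        using \<phi>0[OF n1] by (intro mult_left_mono)
      moreover have "inner (d n) (x n - u) = - inner (F (x n)) (x n - u) + \<phi> n * inner (d k) (x n - u)"
        using drec[OF k(2)] by (simp add: k(1) inner_diff_left)
      ultimately show ?thesis by (simp add: inner_diff_left)
    qed
    have "(norm (y n - u))\<^sup>2
        = s n + 2 * \<mu> * \<beta> n * inner (d n) (x n - u) + \<mu>\<^sup>2 * (\<beta> n)\<^sup>2 * (norm (d n))\<^sup>2"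
      unfolding s_def yrec[OF n1] power2_norm_eq_inner
      by (simp add: inner_diff_left inner_diff_right inner_add_left inner_add_right inner_commute
          algebra_simps power2_eq_square)
    moreover have "2 * \<mu> * \<beta> n * inner (d n) (x n - u)
        \<le> 2 * \<mu> * \<beta> n * (- \<eta> * s n + (\<phi> n * (D * R) - inner (F u) (x n - u)))"
      using dx \<mu> \<beta>0[OF n1] by (intro mult_left_mono) auto
    moreover have "\<mu>\<^sup>2 * (\<beta> n)\<^sup>2 * (norm (d n))\<^sup>2 \<le> \<mu>\<^sup>2 * (\<beta> n)\<^sup>2 * D\<^sup>2"
      using D[of n] by (intro mult_left_mono power_mono) auto
    ultimately have "(norm (y n - u))\<^sup>2 \<le> (1 - g * \<beta> n) * s n + \<beta> n * b n"
      unfolding b_def g_def by (simp add: algebra_simps power2_eq_square)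
    with 1 show ?thesis by simp
  qed

  have b_upper: "eventually (\<lambda>n. b n \<le> 2 * \<mu> * (D * R + norm (F u) * R) + \<mu>\<^sup>2 * D\<^sup>2) sequentially"
  proof -
    have "eventually (\<lambda>n. \<phi> n < 1) sequentially" "eventually (\<lambda>n. \<beta> n < 1) sequentially"
      using \<phi> \<beta> by (auto intro: order_tendstoD)
    then show ?thesis using eventually_ge_at_top[of 1]
    proof eventually_elim
      case (elim n)
      have "\<phi> n * (D * R) \<le> 1 * (D * R)"
        using elim D0 R0 by (intro mult_right_mono) auto
      moreover have "- inner (F u) (x n - u) \<le> norm (F u) * R"
        using Cauchy_Schwarz_ineq2[of "F u" "x n - u"]
          mult_left_mono[OF R[of n], of "norm (F u)"] elim by simp
      ultimately have "2 * \<mu> * (\<phi> n * (D * R) - inner (F u) (x n - u)) \<le> 2 * \<mu> * (D * R + norm (F u) * R)"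
        using \<mu> by (intro mult_left_mono) auto
      moreover have "\<mu>\<^sup>2 * \<beta> n * D\<^sup>2 \<le> \<mu>\<^sup>2 * 1 * D\<^sup>2"
        using elim by (intro mult_right_mono mult_left_mono) auto
      ultimately show ?case unfolding b_def by simp
    qed
  qed

  have cluster: "\<exists>k. b (r k) \<le> e" if r: "strict_mono r" and Ar: "(\<lambda>k. A (r k)) \<longlonglongrightarrow> 0" and e: "e > 0"
    for r and e :: real
  proof -
    \<comment> \<open>the value \<open>x 0\<close> is not produced by the iteration, so it enters the bound separately\<close>
    have "norm (x n) \<le> max (norm (x 0)) (R + norm u)" for n
    proof (cases "n = 0")
      case False
      then show ?thesis
        using R[of n] norm_triangle_ineq[of "x n - u" u] by simp
    qed simp
    then have "bounded (range (x \<circ> r))"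
      by (intro boundedI) auto
    then obtain r' p where r': "strict_mono r'" and wx: "weakly_converges ((x \<circ> r) \<circ> r') p"
      using bounded_imp_weakly_convergent_subsequence by blast
    define q where "q = r \<circ> r'"
    have q: "strict_mono q" unfolding q_def using r r' by (rule strict_mono_o)
    have q_top: "filterlim q at_top sequentially"
      using q by (rule filterlim_subseq)
    have sub: "(\<lambda>k. f (q k)) \<longlonglongrightarrow> l" if "f \<longlonglongrightarrow> l" for f :: "nat \<Rightarrow> real" and l
      using filterlim_compose[OF that q_top] by simp
    have wx': "weakly_converges (\<lambda>k. x (q k)) p"
      using wx by (simp add: q_def o_def)
    have "(\<lambda>k. norm (y (q k) - x (q k))) \<longlonglongrightarrow> 0"
    proof (rule tendsto_sandwich[OF _ _ tendsto_const])
      have "(\<lambda>k. \<mu> * \<beta> (q k) * D) \<longlonglongrightarrow> \<mu> * 0 * D"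
        by (intro tendsto_intros sub[OF \<beta>])
      then show "(\<lambda>k. \<mu> * \<beta> (q k) * D) \<longlonglongrightarrow> 0" by simp
      have "eventually (\<lambda>k. q k \<ge> 1) sequentially"
        using q_top by (auto simp: filterlim_at_top)
      then show "eventually (\<lambda>k. norm (y (q k) - x (q k)) \<le> \<mu> * \<beta> (q k) * D) sequentially"
      proof eventually_elim
        case (elim k)
        show ?case
          using yrec[OF elim] \<mu> \<beta>0[OF elim] D[of "q k"] by (simp add: abs_mult mult_left_mono)
      qed
    qed auto
    then have wy: "weakly_converges (\<lambda>k. y (q k)) p"
      by (rule weakly_converges_norm_close[OF wx'])
    have "(\<lambda>k. 4 / eps\<^sup>2 * A (q k)) \<longlonglongrightarrow> 4 / eps\<^sup>2 * 0"
      using LIMSEQ_subseq_LIMSEQ[OF Ar r'] by (intro tendsto_intros) (simp add: q_def o_def)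
    then have "(\<lambda>k. comp_residual T m (y (q k))) \<longlonglongrightarrow> 0"
      using eps by (simp add: A_def)
    then have "p \<in> (\<Inter>i\<in>{1..m}. Fix (T i))"
      using dc wy by (intro weak_limit_in_common_Fix[where y = "\<lambda>k. y (q k)"])
    then have vi: "inner (F u) (p - u) \<ge> 0"
      using u by (auto simp: vi_solution_def)
    have "(\<lambda>k. b (q k)) \<longlonglongrightarrow> 2 * \<mu> * (0 * (D * R) - (inner (F u) p - inner (F u) u)) + \<mu>\<^sup>2 * 0 * D\<^sup>2"
      unfolding b_def inner_diff_right
      by (intro tendsto_intros sub[OF \<phi>] sub[OF \<beta>] wx'[unfolded weakly_converges_def, rule_format])
    moreover have "2 * \<mu> * (0 * (D * R) - (inner (F u) p - inner (F u) u)) + \<mu>\<^sup>2 * 0 * D\<^sup>2 < e"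
    proof -
      have "0 \<le> 2 * \<mu> * inner (F u) (p - u)" using vi \<mu> by simp
      then show ?thesis using e by (simp add: inner_diff_right algebra_simps)
    qed
    ultimately have "eventually (\<lambda>k. b (q k) < e) sequentially"
      by (rule order_tendstoD)
    then obtain k where "b (q k) < e"
      by (auto simp: eventually_sequentially)
    then show ?thesis unfolding q_def by (auto intro!: exI[of _ "r' k"])
  qed

  have "s \<longlonglongrightarrow> 0"
  proof (rule perturbed_descent_tendsto_0[OF _ _ _ _ _ \<beta> div b_upper cluster])
    show "eventually (\<lambda>n. s (Suc n) \<le> (1 - g * \<beta> n) * s n + \<beta> n * b n - A n) sequentially"
      using eventually_ge_at_top[of 2] by eventually_elim (rule descent)
    show "eventually (\<lambda>n. 0 \<le> \<beta> n) sequentially"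
      using eventually_ge_at_top[of 1] by eventually_elim (rule \<beta>0)
    show "0 \<le> A n" for n
      by (simp add: A_def comp_residual_nonneg)
  qed (auto simp: s_def g_def \<mu> \<eta>)
  then have "(\<lambda>n. norm (x n - u)) \<longlonglongrightarrow> 0"
    using tendsto_real_sqrt[of s 0 sequentially] by (simp add: s_def)
  then show ?thesis
    by (simp add: tendsto_norm_zero_iff LIM_zero_iff)
qed

theorem theorem3:
  fixes T :: "nat \<Rightarrow> 'a::{real_inner, complete_space} \<Rightarrow> 'a"
    and F :: "'a \<Rightarrow> 'a"
    and m :: nat
    and \<eta> \<kappa> \<mu> eps :: real
    and \<beta> \<phi> lam :: "nat \<Rightarrow> real"
    and x y d :: "nat \<Rightarrow> 'a"
  assumes "m \<ge> 1"
    and "\<And>i. i \<in> {1..m} \<Longrightarrow> cutter (T i)"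
    and "(\<Inter>i\<in>{1..m}. Fix (T i)) \<noteq> {}"
    and "strongly_monotone \<eta> F"
    and "\<kappa> > 0" and "\<kappa>-lipschitz_on UNIV F"
    and "\<mu> \<in> {0<..<2 * \<eta> / \<kappa>\<^sup>2}"
    and "\<And>n. n \<ge> 1 \<Longrightarrow> \<beta> n \<in> {0<..1}"
    and "\<And>n. n \<ge> 1 \<Longrightarrow> \<phi> n \<ge> 0"
    and "\<And>n. n \<ge> 1 \<Longrightarrow> lam n > 0"
    and "escom_cgd m T F \<mu> \<beta> \<phi> lam x y d"
    and "\<beta> \<longlonglongrightarrow> 0"
    and "filterlim (\<lambda>N. \<Sum>n=1..N. \<beta> n) at_top at_top"
    and "\<phi> \<longlonglongrightarrow> 0"
    and "eps \<in> {0<..<1}" and "\<And>n. n \<ge> 1 \<Longrightarrow> lam n \<in> {eps..2 - eps}"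
    and "bounded ((\<lambda>n. F (x n)) ` {1..})"
    and "\<And>i. i \<in> {1..m} \<Longrightarrow> demiclosed_principle (T i)"
  shows "\<exists>u. vi_solution F (\<Inter>i\<in>{1..m}. Fix (T i)) u
           \<and> (\<forall>v. vi_solution F (\<Inter>i\<in>{1..m}. Fix (T i)) v \<longrightarrow> v = u)
           \<and> x \<longlonglongrightarrow> u"
proof -
  let ?C = "\<Inter>i\<in>{1..m}. Fix (T i)"
  have "closed ?C" "convex ?C"
    using cutter_Fix_closed_convex[OF assms(2)] by (auto intro!: closed_INT convex_INT)
  then obtain u where u: "vi_solution F ?C u"
    using strongly_monotone_vi_solution_exists[OF assms(4,6,5)] assms(3) by blast
  moreover have "v = u" if "vi_solution F ?C v" for v
    using strongly_monotone_vi_solution_unique[OF assms(4) u that] .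
  moreover have "x \<longlonglongrightarrow> u"
    using assms u
    by (intro escom_cgd_tendsto_vi_solution[of m T \<eta> F \<mu> \<beta> \<phi> lam x y d eps u])
      (auto simp: less_imp_le)
  ultimately show ?thesis by blast
qed

end
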